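(* Let $T>0$, $F:\mathbb{R}\times\mathbb{R}\to\mathbb{R}$, $x\in\mathbb{R}$. Assume that $\mathbf{x}$ is the unique solution on $[0,T]$ of $$\frac{d\mathbf{x}}{dt}(t)=F(\mathbf{x}(t),t),\qquad\mathbf{x}(0)=x,$$ that $F$ has third-order continuous partial derivatives, and that $$F_x(\mathbf{x}(t),t)<0\qquad\forall\,0\le t\le T.$$ Then there exist a positive number $\delta_2$ and constants $\beta_1,\ldots,\beta_6$, all depending only on $\mathbf{x}$ and $F$, such that the following holds. Let $\mathbb{L}$ be the cubic spline space on $[0,T]$ with knots $\tau$, where $|\tau|\le1$. For any $$\hat{\mathbf{x}}_0\in\operatorname*{arg\,min}_{\hat{\mathbf{x}}\in\mathbb{L},\ \hat{\mathbf{x}}(0)=x,\ \|\hat{\mathbf{x}}-\mathbf{x}\|_\infty<\delta_2}J(\hat{\mathbf{x}}),$$ we have $$\|\mathbf{x}-\hat{\mathbf{x}}_0\|_\infty<\beta_1\kappa\left\|\frac{d^2\hat{\mathbf{x}}_0}{dt^2}\right\|_{L^2[0,T]}|\tau|^{1/2}+\beta_2\kappa|\tau|+\kappa(4\sqrt{6\kappa}+\beta_3)\beta_4\sqrt T|\tau|^{3/2}+\beta_5\sqrt T|\tau|^3+\beta_6\sqrt T|\tau|^{7/2}.$$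
   Context: $F_x$ denotes the partial derivative of $F$ with respect to its first argument. $\|f\|_\infty=\sup_{t\in[0,T]}|f(t)|$ and $\|f\|_{L^2[0,T]}=(\int_0^T|f|^2dt)^{1/2}$. For knots $\tau=(0=t_1<\cdots<t_k=T)$, the cubic spline space $\mathbb{L}$ is the space of B-spline functions of order $4$ with these knots (twice continuously differentiable functions on $[0,T]$ that are polynomials of degree at most 3 on each $[t_{i-1},t_i]$); $|\tau|=\max_{2\le i\le k}|t_i-t_{i-1}|$ and the mesh ratio is $\kappa=|\tau|/\min_{2\le i\le k}|t_i-t_{i-1}|$. For $\hat{\mathbf{x}}\in\mathbb{L}$, $J(\hat{\mathbf{x}})=\int_0^T\left|\frac{d\hat{\mathbf{x}}}{dt}(t)-F(\hat{\mathbf{x}}(t),t)\right|^2dt$. *)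

theory Defs
  imports "HOL-Analysis.Analysis" "HOL-Computational_Algebra.Polynomial"
begin

definition partial_fst :: "(real \<times> real \<Rightarrow> real) \<Rightarrow> real \<times> real \<Rightarrow> real" where
  "partial_fst F = (\<lambda>(x, t). deriv (\<lambda>u. F (u, t)) x)"

definition partial_snd :: "(real \<times> real \<Rightarrow> real) \<Rightarrow> real \<times> real \<Rightarrow> real" where
  "partial_snd F = (\<lambda>(x, t). deriv (\<lambda>s. F (x, s)) t)"

text \<open>All partial derivatives of order at most \<open>n\<close>, mixed ones in every order of
  differentiation, exist everywhere and are jointly continuous.\<close>

primrec continuous_partials :: "nat \<Rightarrow> (real \<times> real \<Rightarrow> real) \<Rightarrow> bool" where
  "continuous_partials 0 F \<longleftrightarrow> continuous_on UNIV F"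
| "continuous_partials (Suc n) F \<longleftrightarrow>
     continuous_on UNIV F \<and>
     (\<forall>x t. (\<lambda>u. F (u, t)) field_differentiable at x \<and> (\<lambda>s. F (x, s)) field_differentiable at t) \<and>
     continuous_partials n (partial_fst F) \<and> continuous_partials n (partial_snd F)"

text \<open>Functions on \<open>[0, T]\<close> are represented by total functions on the reals whose values outside
  \<open>[0, T]\<close> are irrelevant; derivatives are therefore taken within \<open>{0..T}\<close>, that is, they are
  one-sided at the endpoints.\<close>

definition ode_solution ::
    "(real \<times> real \<Rightarrow> real) \<Rightarrow> real \<Rightarrow> real \<Rightarrow> (real \<Rightarrow> real) \<Rightarrow> bool" where
  "ode_solution F T x0 y \<longleftrightarrow>
     y 0 = x0 \<and> (\<forall>t\<in>{0..T}. (y has_real_derivative F (y t, t)) (at t within {0..T}))"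

definition unique_ode_solution ::
    "(real \<times> real \<Rightarrow> real) \<Rightarrow> real \<Rightarrow> real \<Rightarrow> (real \<Rightarrow> real) \<Rightarrow> bool" where
  "unique_ode_solution F T x0 x \<longleftrightarrow>
     ode_solution F T x0 x \<and> (\<forall>y. ode_solution F T x0 y \<longrightarrow> (\<forall>t\<in>{0..T}. y t = x t))"

definition ddt :: "real \<Rightarrow> (real \<Rightarrow> real) \<Rightarrow> real \<Rightarrow> real" where
  "ddt T f = (\<lambda>t. vector_derivative f (at t within {0..T}))"

definition sup_norm :: "real \<Rightarrow> (real \<Rightarrow> real) \<Rightarrow> real" where
  "sup_norm T f = (SUP t\<in>{0..T}. \<bar>f t\<bar>)"

definition L2_norm_on :: "real \<Rightarrow> (real \<Rightarrow> real) \<Rightarrow> real" where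
  "L2_norm_on T f = sqrt (integral {0..T} (\<lambda>t. \<bar>f t\<bar>\<^sup>2))"

text \<open>Knots \<open>0 = \<tau> 1 < \<dots> < \<tau> k = T\<close>, indexed from 1.\<close>

definition knots :: "real \<Rightarrow> nat \<Rightarrow> (nat \<Rightarrow> real) \<Rightarrow> bool" where
  "knots T k \<tau> \<longleftrightarrow> 2 \<le> k \<and> \<tau> 1 = 0 \<and> \<tau> k = T \<and> strict_mono_on {1..k} \<tau>"

definition mesh :: "nat \<Rightarrow> (nat \<Rightarrow> real) \<Rightarrow> real" where
  "mesh k \<tau> = Max ((\<lambda>i. \<bar>\<tau> i - \<tau> (i - 1)\<bar>) ` {2..k})"

definition mesh_ratio :: "nat \<Rightarrow> (nat \<Rightarrow> real) \<Rightarrow> real" where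
  "mesh_ratio k \<tau> = mesh k \<tau> / Min ((\<lambda>i. \<bar>\<tau> i - \<tau> (i - 1)\<bar>) ` {2..k})"

definition cubic_splines :: "real \<Rightarrow> nat \<Rightarrow> (nat \<Rightarrow> real) \<Rightarrow> (real \<Rightarrow> real) set" where
  "cubic_splines T k \<tau> = {s.
     s differentiable_on {0..T} \<and> ddt T s differentiable_on {0..T} \<and>
     continuous_on {0..T} (ddt T (ddt T s)) \<and>
     (\<forall>i\<in>{2..k}. \<exists>p :: real poly. degree p \<le> 3 \<and> (\<forall>t\<in>{\<tau> (i - 1)..\<tau> i}. s t = poly p t))}"

definition J :: "(real \<times> real \<Rightarrow> real) \<Rightarrow> real \<Rightarrow> (real \<Rightarrow> real) \<Rightarrow> real" where
  "J F T s = integral {0..T} (\<lambda>t. \<bar>ddt T s t - F (s t, t)\<bar>\<^sup>2)"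

end

theory Submission imports Defs begin

text \<open>
  The right-hand side of the claim contains the term \<open>\<beta>\<^sub>2 \<kappa> |\<tau>|\<close>, and the error of the minimizer is
  in fact \<open>O(|\<tau>|)\<close> with a constant that depends on \<open>\<^bold>x\<close>, \<open>F\<close> and \<open>T\<close> only. Since \<open>\<kappa> \<ge> 1\<close>, the theorem
  follows with the other coefficients equal to zero.

  To see this, let \<open>L\<close> be a Lipschitz constant of the derivative \<open>t \<mapsto> F (\<^bold>x t, t)\<close> of the solution.
  There is a quadratic spline of class \<open>C\<^sup>1\<close> within \<open>2 L |\<tau>|\<close> of it, namely the one whose B-spline
  coefficients are its values at the knots. The primitive \<open>s\<close> of that spline with \<open>s 0 = \<^bold>x 0\<close> is a
  cubic spline that satisfies \<open>|s - \<^bold>x| \<le> 2 L T |\<tau>|\<close>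
  (lemma \<open>spline_with_derivative_near_Lipschitz_function\<close>). If \<open>2 L T |\<tau>| < 1\<close>, then \<open>s\<close> competes with
  the minimizer in the tube of radius \<open>\<delta>\<^sub>2 = 1\<close>, and its residual \<open>s' - F (s, \<cdot>)\<close> is \<open>O(|\<tau>|)\<close>, so the minimum
  of the functional is \<open>O(|\<tau>|\<^sup>2)\<close>. On the tube \<open>F\<close> is Lipschitz, and a Gronwall argument for the
  square of the error (lemma \<open>error_le_L2_residual\<close>) turns this bound on the residual of the minimizer
  in \<open>L\<^sup>2\<close> into a uniform bound of order \<open>|\<tau>|\<close> on its error. If \<open>2 L T |\<tau>| \<ge> 1\<close>, the minimizer lies in
  the tube, and so its error is at most \<open>1 \<le> 2 L T |\<tau>|\<close>.
\<close>

section \<open>Cubic splines with prescribed second derivatives at the knots\<close>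

text \<open>The kernel \<open>(t - a)\<^sub>+\<^sup>3\<close>, written as a product with one positive part so that the derivatives
  are given by the product rule. Adding a multiple of it changes a spline only to the right of the
  knot \<open>a\<close> and keeps it of class \<open>C\<^sup>2\<close>.\<close>

lemma cubic_kernel_derivatives:
  fixes a t :: real
  shows "((\<lambda>t. (t - a) * max 0 (t - a)) has_real_derivative 2 * max 0 (t - a)) (at t)"
    and "((\<lambda>t. (t - a) * ((t - a) * max 0 (t - a))) has_real_derivative
          3 * ((t - a) * max 0 (t - a))) (at t)"
proof -
  show *: "((\<lambda>t. (t - a) * max 0 (t - a)) has_real_derivative 2 * max 0 (t - a)) (at t)"
  proof (cases t a rule: linorder_cases)
    case less
    have "((\<lambda>t. 0) has_real_derivative 2 * max 0 (t - a)) (at t)"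
      using less by (auto intro!: derivative_eq_intros)
    then show ?thesis
      by (rule has_field_derivative_transform_within_open[where S = "{..<a}"])
        (use less in auto)
  next
    case greater
    have "((\<lambda>t. (t - a)\<^sup>2) has_real_derivative 2 * max 0 (t - a)) (at t)"
      using greater by (auto intro!: derivative_eq_intros)
    then show ?thesis
      by (rule has_field_derivative_transform_within_open[where S = "{a<..}"])
        (use greater in \<open>auto simp: power2_eq_square\<close>)
  next
    case equal
    have "((\<lambda>h::real. max 0 h) \<longlongrightarrow> max 0 0) (at 0)"
      by (intro tendsto_intros)
    then have "((\<lambda>h::real. max 0 h) \<longlongrightarrow> 0) (at 0)"
      by simp
    then have "((\<lambda>h::real. (h * max 0 h) / h) \<longlongrightarrow> 0) (at 0)"
      by (rule Lim_transform_eventually) (auto simp: eventually_at_filter)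
    then show ?thesis
      using equal by (simp add: DERIV_def)
  qed
  show "((\<lambda>t. (t - a) * ((t - a) * max 0 (t - a))) has_real_derivative
          3 * ((t - a) * max 0 (t - a))) (at t)"
    by (rule derivative_eq_intros * refl | simp add: algebra_simps)+
qed

lemma shifted_cubic_is_poly:
  fixes a A B C D :: real
  shows "\<exists>q :: real poly. degree q \<le> 3 \<and>
    (\<forall>t. poly q t = A + B * (t - a) + C * (t - a)\<^sup>2 + D * (t - a) ^ 3)"
proof (intro exI conjI allI)
  let ?q = "pcompose [:A, B, C, D:] [:- a, 1:]"
  have "degree [:A, B, C, D:] \<le> 3"
    by simp
  then show "degree ?q \<le> 3"
    using degree_pcompose_le[of "[:A, B, C, D:]" "[:- a, 1:]"] by simp
  show "poly ?q t = A + B * (t - a) + C * (t - a)\<^sup>2 + D * (t - a) ^ 3" for t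
    by (simp add: poly_pcompose power2_eq_square power3_eq_cube algebra_simps)
qed

text \<open>The function is built from left to right. Beyond the last knot treated it is a single cubic
  with one coefficient still at our disposal: the truncated cubic at that knot is added with the
  multiple that gives the required second derivative at the next knot. The last conjunct, which
  describes this rightmost cubic, is what carries the induction. The formula for the first derivative
  on a knot interval is the primitive of the linear interpolant of \<open>d\<close>.\<close>

lemma spline_with_prescribed_second_derivatives:
  fixes \<tau> d :: "nat \<Rightarrow> real" and a v :: real
  assumes "n \<ge> 1" and "strict_mono_on {1..n} \<tau>"
  shows "\<exists>s s1 s2 A b. (\<forall>t. (s has_real_derivative s1 t) (at t)) \<and>
    (\<forall>t. (s1 has_real_derivative s2 t) (at t)) \<and> continuous_on UNIV s2 \<and>
    s (\<tau> 1) = a \<and> s1 (\<tau> 1) = v \<and>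
    (\<forall>i\<in>{1..<n}. (\<exists>q :: real poly. degree q \<le> 3 \<and> (\<forall>t\<in>{\<tau> i..\<tau> (Suc i)}. s t = poly q t)) \<and>
      (\<forall>t\<in>{\<tau> i..\<tau> (Suc i)}. s1 t = s1 (\<tau> i) + d i * (t - \<tau> i) +
        (d (Suc i) - d i) / (2 * (\<tau> (Suc i) - \<tau> i)) * (t - \<tau> i)\<^sup>2)) \<and>
    (\<forall>t\<ge>\<tau> n. s t = A + s1 (\<tau> n) * (t - \<tau> n) + d n / 2 * (t - \<tau> n)\<^sup>2 + b * (t - \<tau> n) ^ 3 \<and>
      s1 t = s1 (\<tau> n) + d n * (t - \<tau> n) + 3 * b * (t - \<tau> n)\<^sup>2)"
  using assms
proof (induction n rule: dec_induct)
  case base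
  show ?case
    by (rule exI[of _ "\<lambda>t. a + v * (t - \<tau> 1) + d 1 / 2 * (t - \<tau> 1)\<^sup>2"],
        rule exI[of _ "\<lambda>t. v + d 1 * (t - \<tau> 1)"], rule exI[of _ "\<lambda>t. d 1"],
        rule exI[of _ a], rule exI[of _ 0])
      (auto intro!: derivative_eq_intros)
next
  case (step n)
  have "strict_mono_on {1..n} \<tau>"
    using step.prems by (auto simp: strict_mono_on_def)
  then obtain s s1 s2 A b where
    D: "\<And>t. (s has_real_derivative s1 t) (at t)" "\<And>t. (s1 has_real_derivative s2 t) (at t)"
    and cont: "continuous_on UNIV s2" and init: "s (\<tau> 1) = a" "s1 (\<tau> 1) = v"
    and poly: "\<And>i. i \<in> {1..<n} \<Longrightarrow>
       \<exists>q :: real poly. degree q \<le> 3 \<and> (\<forall>t\<in>{\<tau> i..\<tau> (Suc i)}. s t = poly q t)"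
    and s1: "\<And>i t. i \<in> {1..<n} \<Longrightarrow> t \<in> {\<tau> i..\<tau> (Suc i)} \<Longrightarrow> s1 t = s1 (\<tau> i) + d i * (t - \<tau> i) +
        (d (Suc i) - d i) / (2 * (\<tau> (Suc i) - \<tau> i)) * (t - \<tau> i)\<^sup>2"
    and tail: "\<And>t. t \<ge> \<tau> n \<Longrightarrow>
        s t = A + s1 (\<tau> n) * (t - \<tau> n) + d n / 2 * (t - \<tau> n)\<^sup>2 + b * (t - \<tau> n) ^ 3"
    and tail1: "\<And>t. t \<ge> \<tau> n \<Longrightarrow> s1 t = s1 (\<tau> n) + d n * (t - \<tau> n) + 3 * b * (t - \<tau> n)\<^sup>2"
    using step.IH by blast
  define h where "h = \<tau> (Suc n) - \<tau> n"
  have "h > 0"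
    using step.prems \<open>1 \<le> n\<close> by (auto simp: strict_mono_on_def h_def)
  have mono: "\<tau> i \<le> \<tau> n" if "i \<in> {1..n}" for i
    using step.prems that by (cases "i = n") (auto simp: strict_mono_on_def less_imp_le)
  \<comment> \<open>\<open>6 b'\<close> is the slope of the linear interpolant of \<open>d\<close>, so the cubic coefficient has to change
    from \<open>b\<close> to \<open>b'\<close> at the knot.\<close>
  define c where "c = (d (Suc n) - d n) / (2 * h)"
  define b' where "b' = c / 3"
  define r where "r t = s t + (b' - b) * ((t - \<tau> n) * ((t - \<tau> n) * max 0 (t - \<tau> n)))" for t
  define r1 where "r1 t = s1 t + 3 * (b' - b) * ((t - \<tau> n) * max 0 (t - \<tau> n))" for t
  define r2 where "r2 t = s2 t + 6 * (b' - b) * max 0 (t - \<tau> n)" for t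
  have "(r has_real_derivative r1 t) (at t)" "(r1 has_real_derivative r2 t) (at t)" for t
    unfolding r_def r1_def r2_def
    by (rule derivative_eq_intros D cubic_kernel_derivatives refl | simp)+
  moreover have "continuous_on UNIV r2"
    unfolding r2_def by (intro continuous_intros cont)
  moreover have left: "r t = s t" "r1 t = s1 t" if "t \<le> \<tau> n" for t
    using that by (auto simp: r_def r1_def)
  then have "r (\<tau> 1) = a" "r1 (\<tau> 1) = v"
    using init mono[of 1] \<open>1 \<le> n\<close> by auto
  moreover
  have right: "r t = A + s1 (\<tau> n) * (t - \<tau> n) + d n / 2 * (t - \<tau> n)\<^sup>2 + b' * (t - \<tau> n) ^ 3"
    and right1: "r1 t = s1 (\<tau> n) + d n * (t - \<tau> n) + 3 * b' * (t - \<tau> n)\<^sup>2" if "t \<ge> \<tau> n" for t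
    using that tail[OF that] tail1[OF that]
    by (simp_all add: r_def r1_def algebra_simps power2_eq_square power3_eq_cube)
  have "(\<exists>q :: real poly. degree q \<le> 3 \<and> (\<forall>t\<in>{\<tau> i..\<tau> (Suc i)}. r t = poly q t)) \<and>
      (\<forall>t\<in>{\<tau> i..\<tau> (Suc i)}. r1 t = r1 (\<tau> i) + d i * (t - \<tau> i) +
        (d (Suc i) - d i) / (2 * (\<tau> (Suc i) - \<tau> i)) * (t - \<tau> i)\<^sup>2)"
    if i: "i \<in> {1..<Suc n}" for i
  proof (cases "i = n")
    case True
    obtain q :: "real poly" where "degree q \<le> 3" "\<And>t. poly q t =
        A + s1 (\<tau> n) * (t - \<tau> n) + d n / 2 * (t - \<tau> n)\<^sup>2 + b' * (t - \<tau> n) ^ 3"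
      using shifted_cubic_is_poly by metis
    then have "\<exists>q :: real poly. degree q \<le> 3 \<and> (\<forall>t\<in>{\<tau> n..\<tau> (Suc n)}. r t = poly q t)"
      using right by auto
    moreover have "3 * b' = c"
      by (simp add: b'_def)
    then have "3 * b' = (d (Suc n) - d n) / (2 * (\<tau> (Suc n) - \<tau> n))"
      unfolding c_def h_def .
    then have "\<forall>t\<in>{\<tau> n..\<tau> (Suc n)}. r1 t = r1 (\<tau> n) + d n * (t - \<tau> n) +
        (d (Suc n) - d n) / (2 * (\<tau> (Suc n) - \<tau> n)) * (t - \<tau> n)\<^sup>2"
      using right1 left by auto
    ultimately show ?thesis
      unfolding True by (rule conjI)
  next
    case False
    then have i': "i \<in> {1..<n}" "\<tau> i \<le> \<tau> n" "\<tau> (Suc i) \<le> \<tau> n"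
      using i mono by auto
    have same: "r t = s t" "r1 t = s1 t" if "t \<in> {\<tau> i..\<tau> (Suc i)}" for t
      using left that i' by auto
    show ?thesis
    proof (intro conjI ballI)
      show "\<exists>q :: real poly. degree q \<le> 3 \<and> (\<forall>t\<in>{\<tau> i..\<tau> (Suc i)}. r t = poly q t)"
        using poly[OF i'(1)] by (simp add: same(1))
      fix t assume t: "t \<in> {\<tau> i..\<tau> (Suc i)}"
      show "r1 t = r1 (\<tau> i) + d i * (t - \<tau> i) +
          (d (Suc i) - d i) / (2 * (\<tau> (Suc i) - \<tau> i)) * (t - \<tau> i)\<^sup>2"
        unfolding same(2)[OF t] left(2)[OF i'(2)] by (rule s1[OF i'(1) t])
    qed
  qed
  moreover
  define A' where "A' = A + s1 (\<tau> n) * h + d n / 2 * h\<^sup>2 + b' * h ^ 3"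
  have "r t = A' + r1 (\<tau> (Suc n)) * (t - \<tau> (Suc n)) + d (Suc n) / 2 * (t - \<tau> (Suc n))\<^sup>2
        + b' * (t - \<tau> (Suc n)) ^ 3 \<and>
      r1 t = r1 (\<tau> (Suc n)) + d (Suc n) * (t - \<tau> (Suc n)) + 3 * b' * (t - \<tau> (Suc n))\<^sup>2"
    if t: "t \<ge> \<tau> (Suc n)" for t
  proof -
    define u where "u = t - \<tau> (Suc n)"
    have tn: "t - \<tau> n = u + h" "t \<ge> \<tau> n"
      using t \<open>h > 0\<close> by (auto simp: u_def h_def)
    have R: "r1 (\<tau> (Suc n)) = s1 (\<tau> n) + d n * h + 3 * b' * h\<^sup>2"
      using right1[of "\<tau> (Suc n)"] \<open>h > 0\<close> by (simp add: h_def)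
    have d: "d (Suc n) = d n + 6 * b' * h"
      using \<open>h > 0\<close> by (simp add: b'_def c_def field_simps)
    show ?thesis
      unfolding right[OF tn(2)] right1[OF tn(2)] tn(1) R d A'_def u_def[symmetric]
      by (simp add: algebra_simps power2_eq_square power3_eq_cube)
  qed
  ultimately show ?case
    by blast
qed

section \<open>Approximation of a Lipschitz derivative by a spline\<close>

text \<open>On an interval of length \<open>h\<close>, with \<open>w = u / h\<close>, the quadratic piece deviates from its middle
  Bezier coefficient by \<open>w\<^sup>2 (q h / 2) - (1 - w)\<^sup>2 (p h / 2)\<close>, where \<open>p\<close> and \<open>q\<close> are the end slopes, and
  \<open>w\<^sup>2 + (1 - w)\<^sup>2 \<le> 1\<close>.\<close>

lemma quadratic_spline_weights:
  fixes u h p q B :: real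
  assumes "0 \<le> u" "u \<le> h" "h > 0" "\<bar>p * h / 2\<bar> \<le> B" "\<bar>q * h / 2\<bar> \<le> B"
  shows "\<bar>p * u + (q - p) / (2 * h) * u\<^sup>2 - p * h / 2\<bar> \<le> B"
proof -
  define w where "w = u / h"
  have w: "0 \<le> w" "w \<le> 1" "u = w * h"
    using assms by (auto simp: w_def)
  have "p * u + (q - p) / (2 * h) * u\<^sup>2 - p * h / 2 = (q * h / 2) * w\<^sup>2 - (p * h / 2) * (1 - w)\<^sup>2"
    unfolding w using \<open>h > 0\<close> by (simp add: field_simps power2_eq_square)
  also have "\<bar>\<dots>\<bar> \<le> \<bar>q * h / 2\<bar> * w\<^sup>2 + \<bar>p * h / 2\<bar> * (1 - w)\<^sup>2"
    by (rule order_trans[OF abs_triangle_ineq4]) (simp add: abs_mult)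
  also have "\<dots> \<le> B * w\<^sup>2 + B * (1 - w)\<^sup>2"
    using assms by (intro add_mono mult_right_mono) auto
  also have "\<dots> = B * (w\<^sup>2 + (1 - w)\<^sup>2)"
    by (simp add: algebra_simps)
  also have "\<dots> \<le> B * 1"
  proof (rule mult_left_mono)
    have "w * (1 - w) \<ge> 0"
      using w by simp
    then show "w\<^sup>2 + (1 - w)\<^sup>2 \<le> 1"
      by (simp add: power2_eq_square algebra_simps)
    show "0 \<le> B"
      using assms by linarith
  qed
  finally show ?thesis
    by simp
qed

lemma knot_step:
  assumes "knots T k \<tau>" "i \<in> {1..<k}"
  shows "0 \<le> \<tau> i" "\<tau> i < \<tau> (Suc i)" "\<tau> (Suc i) \<le> T" "\<tau> (Suc i) - \<tau> i \<le> mesh k \<tau>"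
proof -
  have k: "2 \<le> k" "\<tau> 1 = 0" "\<tau> k = T" and mono: "strict_mono_on {1..k} \<tau>"
    using assms by (auto simp: knots_def)
  have le: "\<tau> i \<le> \<tau> j" if "1 \<le> i" "i \<le> j" "j \<le> k" for i j
    using strict_mono_on_imp_mono_on[OF mono] that by (auto simp: mono_on_def)
  show "0 \<le> \<tau> i" "\<tau> (Suc i) \<le> T"
    using le[of 1 i] le[of "Suc i" k] assms k by auto
  show "\<tau> i < \<tau> (Suc i)"
    using mono assms by (auto simp: strict_mono_on_def)
  have "\<bar>\<tau> (Suc i) - \<tau> (Suc i - 1)\<bar> \<le> mesh k \<tau>"
    unfolding mesh_def using assms(2) by (intro Max_ge finite_imageI imageI) auto
  then show "\<tau> (Suc i) - \<tau> i \<le> mesh k \<tau>"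
    by simp
qed

lemma knot_interval:
  assumes "knots T k \<tau>" "t \<in> {0..T}"
  obtains i where "i \<in> {1..<k}" "t \<in> {\<tau> i..\<tau> (Suc i)}"
proof -
  have k: "2 \<le> k" "\<tau> 1 = 0" "\<tau> k = T"
    using assms by (auto simp: knots_def)
  have "\<exists>i\<in>{1..<j}. t \<in> {\<tau> i..\<tau> (Suc i)}" if "2 \<le> j" "t \<le> \<tau> j" for j
    using that
  proof (induction j rule: dec_induct)
    case base
    then show ?case
      using assms k by (auto simp: numeral_2_eq_2)
  next
    case (step j)
    then show ?case
    proof (cases "t \<le> \<tau> j")
      case True
      then show ?thesis
        using step.IH by fastforce
    next
      case False
      then show ?thesis
        using step by (intro bexI[of _ j]) auto
    qed
  qed
  from this[of k] show thesis
    using that k assms(2) by auto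
qed

lemma mesh_pos_and_ratio_ge_1:
  assumes "knots T k \<tau>"
  shows "mesh k \<tau> > 0" "mesh_ratio k \<tau> \<ge> 1"
proof -
  let ?A = "(\<lambda>i. \<bar>\<tau> i - \<tau> (i - 1)\<bar>) ` {2..k}"
  have A: "finite ?A" "?A \<noteq> {}"
    using assms by (auto simp: knots_def)
  have "0 < \<bar>\<tau> i - \<tau> (i - 1)\<bar>" if "i \<in> {2..k}" for i
    using knot_step(2)[OF assms, of "i - 1"] that by (cases i) auto
  then have "0 < Min ?A"
    using A by (subst Min_gr_iff) auto
  moreover have "Min ?A \<le> Max ?A"
    using A by (intro Max_ge Min_in)
  ultimately show "mesh k \<tau> > 0" "mesh_ratio k \<tau> \<ge> 1"
    by (auto simp: mesh_def mesh_ratio_def)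
qed

lemma ddt_eqI:
  assumes "T > 0" "t \<in> {0..T}" "(f has_real_derivative D) (at t within {0..T})"
  shows "ddt T f t = D"
  using assms
  by (auto simp: ddt_def has_real_derivative_iff_has_vector_derivative
      intro!: vector_derivative_within_closed_interval)

text \<open>The derivative of the spline is the quadratic spline with coefficient \<open>c i = f (\<tau> i)\<close> on the
  \<open>i\<close>-th interval. Its control polygon joins the heights \<open>c i\<close> above the midpoints of the intervals,
  continued horizontally to both end points, and \<open>d i\<close> is its slope at the \<open>i\<close>-th knot. The quadratic spline is tangent to the polygon at
  the inner knots, and on every interval it stays within \<open>L |\<tau>|\<close> of \<open>c i\<close>, uniformly in the mesh
  ratio, since a polygon slope times half an adjacent interval is at most a difference of
  neighbouring coefficients.\<close>

lemma spline_with_derivative_near_Lipschitz_function: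
  fixes f :: "real \<Rightarrow> real"
  assumes "T > 0" "knots T k \<tau>" "L-lipschitz_on {0..T} f"
  shows "\<exists>s s1. s \<in> cubic_splines T k \<tau> \<and> s 0 = a \<and> continuous_on UNIV s1 \<and>
    (\<forall>t. (s has_real_derivative s1 t) (at t)) \<and>
    (\<forall>t\<in>{0..T}. \<bar>s1 t - f t\<bar> \<le> 2 * L * mesh k \<tau>)"
proof -
  have k: "2 \<le> k" "\<tau> 1 = 0" "\<tau> k = T" and mono: "strict_mono_on {1..k} \<tau>"
    using assms by (auto simp: knots_def)
  define h where "h i = \<tau> (Suc i) - \<tau> i" for i
  define c where "c i = f (\<tau> i)" for i
  define d where "d i = (if 1 < i \<and> i < k then 2 * (c i - c (i - 1)) / (h (i - 1) + h i) else 0)" for i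
  obtain s s1 s2 where
    D: "\<forall>t. (s has_real_derivative s1 t) (at t)" "\<forall>t. (s1 has_real_derivative s2 t) (at t)"
    and cont: "continuous_on UNIV s2" and init': "s (\<tau> 1) = a" "s1 (\<tau> 1) = c 1"
    and pieces: "\<forall>i\<in>{1..<k}. (\<exists>q :: real poly. degree q \<le> 3 \<and> (\<forall>t\<in>{\<tau> i..\<tau> (Suc i)}. s t = poly q t)) \<and>
      (\<forall>t\<in>{\<tau> i..\<tau> (Suc i)}. s1 t = s1 (\<tau> i) + d i * (t - \<tau> i) +
        (d (Suc i) - d i) / (2 * (\<tau> (Suc i) - \<tau> i)) * (t - \<tau> i)\<^sup>2)"
    using spline_with_prescribed_second_derivatives[OF order_trans[OF one_le_numeral k(1)] mono, of a "c 1" d]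
    by (elim exE conjE) (rule that; assumption)
  have init: "s 0 = a" "s1 0 = c 1"
    using init' unfolding k(2) .
  have poly: "\<exists>q :: real poly. degree q \<le> 3 \<and> (\<forall>t\<in>{\<tau> i..\<tau> (Suc i)}. s t = poly q t)"
    and s1: "t \<in> {\<tau> i..\<tau> (Suc i)} \<Longrightarrow> s1 t = s1 (\<tau> i) + d i * (t - \<tau> i) +
        (d (Suc i) - d i) / (2 * h i) * (t - \<tau> i)\<^sup>2" if "i \<in> {1..<k}" for i t
    using pieces that unfolding h_def by blast+
  have L: "0 \<le> L" "\<And>u v. u \<in> {0..T} \<Longrightarrow> v \<in> {0..T} \<Longrightarrow> \<bar>f u - f v\<bar> \<le> L * \<bar>u - v\<bar>"
    using assms(3) by (auto simp: lipschitz_on_def dist_real_def)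
  have h: "0 < h i" "h i \<le> mesh k \<tau>" if "i \<in> {1..<k}" for i
    using knot_step[OF assms(2) that] by (auto simp: h_def)
  have d_small: "\<bar>d i * h i / 2\<bar> \<le> L * mesh k \<tau>" "\<bar>d (Suc i) * h i / 2\<bar> \<le> L * mesh k \<tau>"
    if i: "i \<in> {1..<k}" for i
  proof -
    have *: "\<bar>d (Suc j) * e / 2\<bar> \<le> L * mesh k \<tau>"
      if j: "j \<in> {1..<k}" "Suc j \<in> {1..<k}" "0 \<le> e" "e \<le> h j + h (Suc j)" for j e
    proof -
      have "d (Suc j) * e / 2 = (c (Suc j) - c j) * (e / (h j + h (Suc j)))"
        using j h[OF j(1)] h[OF j(2)] by (simp add: d_def field_simps)
      then have "\<bar>d (Suc j) * e / 2\<bar> = \<bar>c (Suc j) - c j\<bar> * (e / (h j + h (Suc j)))"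
        using j h[OF j(1)] h[OF j(2)] by (simp only: abs_mult) simp
      also have "\<dots> \<le> \<bar>c (Suc j) - c j\<bar> * 1"
        using j h[OF j(1)] h[OF j(2)] by (intro mult_left_mono) auto
      also have "\<dots> \<le> L * h j"
        using L(2)[of "\<tau> (Suc j)" "\<tau> j"] knot_step[OF assms(2) j(1)] by (simp add: c_def h_def)
      also have "\<dots> \<le> L * mesh k \<tau>"
        using h[OF j(1)] L(1) by (intro mult_left_mono) auto
      finally show ?thesis .
    qed
    have m0: "0 \<le> L * mesh k \<tau>"
      using mesh_pos_and_ratio_ge_1(1)[OF assms(2)] L(1) by simp
    show "\<bar>d i * h i / 2\<bar> \<le> L * mesh k \<tau>"
    proof (cases "i = 1")
      case True
      then show ?thesis using m0 by (simp add: d_def)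
    next
      case False
      then obtain j where "i = Suc j" "j \<in> {1..<k}"
        using i by (cases i) auto
      then show ?thesis
        using *[of j "h i"] h[of i] h[of j] i by auto
    qed
    show "\<bar>d (Suc i) * h i / 2\<bar> \<le> L * mesh k \<tau>"
    proof (cases "Suc i = k")
      case True
      then show ?thesis using m0 by (simp add: d_def)
    next
      case False
      then show ?thesis
        using *[of i "h i"] h[of i] h[of "Suc i"] i by auto
    qed
  qed
  \<comment> \<open>The spline passes through the control polygon at the knots. At the first knot this is the
    choice of the initial value, because \<open>d 1 = 0\<close>.\<close>
  have knot_value: "s1 (\<tau> i) = c i - d i * h i / 2" if "1 \<le> i" "i < k" for i
    using that
  proof (induction i rule: dec_induct)
    case base
    then show ?case
      using init k by (simp add: d_def)
  next
    case (step i)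
    have hi: "h i > 0" "h (Suc i) > 0" "\<tau> i \<le> \<tau> (Suc i)"
      using h[of i] h[of "Suc i"] step knot_step[OF assms(2), of i] by auto
    have "s1 (\<tau> (Suc i)) = c i - d i * h i / 2 + d i * h i + (d (Suc i) - d i) / (2 * h i) * (h i)\<^sup>2"
      using s1[of i "\<tau> (Suc i)"] step hi by (simp add: h_def)
    also have "\<dots> = c i + d (Suc i) * h i / 2"
      using hi by (simp add: field_simps power2_eq_square)
    also have "d (Suc i) * (h i + h (Suc i)) / 2 = c (Suc i) - c i"
      using hi step by (simp add: d_def field_simps)
    then have "c i + d (Suc i) * h i / 2 = c (Suc i) - d (Suc i) * h (Suc i) / 2"
      by (simp add: field_simps)
    finally show ?case .
  qed
  have close: "\<bar>s1 t - f t\<bar> \<le> 2 * L * mesh k \<tau>" if t: "t \<in> {0..T}" for t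
  proof -
    obtain i where i: "i \<in> {1..<k}" "t \<in> {\<tau> i..\<tau> (Suc i)}"
      using knot_interval[OF assms(2) t] .
    have "s1 t - c i = d i * (t - \<tau> i) + (d (Suc i) - d i) / (2 * h i) * (t - \<tau> i)\<^sup>2 - d i * h i / 2"
      using s1[OF i] knot_value[of i] i by simp
    also have "\<bar>\<dots>\<bar> \<le> L * mesh k \<tau>"
      using i h[OF i(1)] d_small[OF i(1)] by (intro quadratic_spline_weights) (auto simp: h_def)
    finally have 1: "\<bar>s1 t - c i\<bar> \<le> L * mesh k \<tau>" .
    have "\<bar>c i - f t\<bar> \<le> L * \<bar>\<tau> i - t\<bar>"
      unfolding c_def using t i knot_step[OF assms(2) i(1)] by (intro L) auto
    also have "\<dots> \<le> L * mesh k \<tau>"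
      using i h[OF i(1)] L(1) by (intro mult_left_mono) (auto simp: h_def)
    finally show ?thesis
      using 1 by linarith
  qed
  have within: "(s has_real_derivative s1 t) (at t within {0..T})"
    "(s1 has_real_derivative s2 t) (at t within {0..T})" for t
    using D by (auto intro: has_field_derivative_at_within)
  have dd: "ddt T s t = s1 t" if "t \<in> {0..T}" for t
    using ddt_eqI[OF assms(1) that within(1)] .
  have within': "(ddt T s has_real_derivative s2 t) (at t within {0..T})" if "t \<in> {0..T}" for t
    by (rule has_field_derivative_transform_within[OF within(2) zero_less_one that]) (use dd in auto)
  have dd2: "ddt T (ddt T s) t = s2 t" if "t \<in> {0..T}" for t
    using ddt_eqI[OF assms(1) that within'[OF that]] .
  have "\<exists>q :: real poly. degree q \<le> 3 \<and> (\<forall>t\<in>{\<tau> (i - 1)..\<tau> i}. s t = poly q t)"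
    if "i \<in> {2..k}" for i
  proof -
    have "i - 1 \<in> {1..<k}" "Suc (i - 1) = i"
      using that by auto
    then show ?thesis
      using poly[of "i - 1"] by simp
  qed
  moreover have "continuous_on {0..T} (ddt T (ddt T s))"
    using continuous_on_subset[OF cont, of "{0..T}"] dd2 by (subst continuous_on_cong) auto
  moreover have "s differentiable_on {0..T}" "ddt T s differentiable_on {0..T}"
    using within(1) within' unfolding differentiable_on_def real_differentiable_def by blast+
  ultimately have "s \<in> cubic_splines T k \<tau>"
    unfolding cubic_splines_def by blast
  moreover have "continuous_on UNIV s1"
    by (rule DERIV_continuous_on) (rule D(2)[rule_format])
  ultimately show ?thesis
    using init D(1) close by blast
qed

section \<open>Bounds on compact intervals\<close>

lemma continuous_on_Icc_bounded:
  fixes f :: "real \<Rightarrow> real"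
  assumes "continuous_on {a..b} f"
  obtains B where "B \<ge> 0" "\<And>t. t \<in> {a..b} \<Longrightarrow> \<bar>f t\<bar> \<le> B"
proof -
  have "bounded (f ` {a..b})"
    by (intro compact_imp_bounded compact_continuous_image assms compact_Icc)
  then obtain B where "\<forall>y\<in>f ` {a..b}. norm y \<le> B"
    unfolding bounded_iff by blast
  then have "\<bar>f t\<bar> \<le> max 0 B" if "t \<in> {a..b}" for t
    using that by (auto simp: le_max_iff_disj)
  with that[of "max 0 B"] show thesis
    by simp
qed

lemma sup_norm_lessD:
  assumes "continuous_on {0..T} f" "sup_norm T f < d" "t \<in> {0..T}"
  shows "\<bar>f t\<bar> < d"
proof -
  have "bdd_above ((\<lambda>t. \<bar>f t\<bar>) ` {0..T})"
    by (intro bounded_imp_bdd_above compact_imp_bounded compact_continuous_image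
        continuous_intros assms) auto
  then have "\<bar>f t\<bar> \<le> sup_norm T f"
    unfolding sup_norm_def using assms(3) by (intro cSUP_upper)
  then show ?thesis
    using assms(2) by simp
qed

lemma sup_norm_leI:
  assumes "T \<ge> 0" "\<And>t. t \<in> {0..T} \<Longrightarrow> \<bar>f t\<bar> \<le> B"
  shows "sup_norm T f \<le> B"
  unfolding sup_norm_def using assms by (intro cSUP_least) auto

lemma continuous_partials_imp_Lipschitz_on_box:
  fixes F :: "real \<times> real \<Rightarrow> real"
  assumes "continuous_partials (Suc n) F" "R \<ge> 0" "T \<ge> 0"
  shows "\<exists>M\<ge>0. \<forall>u\<in>{-R..R}. \<forall>v\<in>{-R..R}. \<forall>t\<in>{0..T}. \<forall>r\<in>{0..T}.
    \<bar>F (u, t) - F (v, r)\<bar> \<le> M * (\<bar>u - v\<bar> + \<bar>t - r\<bar>)"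
proof -
  have cont: "continuous_on UNIV (partial_fst F)" "continuous_on UNIV (partial_snd F)"
    using assms(1) by (cases n; simp)+
  have "compact ({-R..R} \<times> {0..T})"
    by (intro compact_Times compact_Icc)
  then have "bounded (partial_fst F ` ({-R..R} \<times> {0..T}))" "bounded (partial_snd F ` ({-R..R} \<times> {0..T}))"
    by (auto intro!: compact_imp_bounded compact_continuous_image continuous_on_subset[OF cont(1)]
        continuous_on_subset[OF cont(2)])
  then obtain M1 M2 where M12: "\<forall>z\<in>{-R..R} \<times> {0..T}. \<bar>partial_fst F z\<bar> \<le> M1"
     "\<forall>z\<in>{-R..R} \<times> {0..T}. \<bar>partial_snd F z\<bar> \<le> M2"
    unfolding bounded_iff by auto
  define M where "M = \<bar>M1\<bar> + \<bar>M2\<bar>"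
  have M: "\<bar>partial_fst F (u, t)\<bar> \<le> M" "\<bar>partial_snd F (u, t)\<bar> \<le> M"
    if "u \<in> {-R..R}" "t \<in> {0..T}" for u t
  proof -
    have "\<bar>partial_fst F (u, t)\<bar> \<le> M1" "\<bar>partial_snd F (u, t)\<bar> \<le> M2"
      using M12 that by blast+
    then show "\<bar>partial_fst F (u, t)\<bar> \<le> M" "\<bar>partial_snd F (u, t)\<bar> \<le> M"
      by (simp_all add: M_def)
  qed
  have D: "((\<lambda>u. F (u, t)) has_real_derivative partial_fst F (u, t)) (at u)"
    "((\<lambda>t. F (u, t)) has_real_derivative partial_snd F (u, t)) (at t)" for u t
    using assms(1) by (auto simp: partial_fst_def partial_snd_def DERIV_deriv_iff_field_differentiable)
  have "\<bar>F (u, t) - F (v, r)\<bar> \<le> M * (\<bar>u - v\<bar> + \<bar>t - r\<bar>)"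
    if uv: "u \<in> {-R..R}" "v \<in> {-R..R}" "t \<in> {0..T}" "r \<in> {0..T}" for u v t r
  proof -
    have "norm (F (u, t) - F (v, t)) \<le> M * norm (u - v)"
      by (rule field_differentiable_bound[of "{-R..R}" "\<lambda>u. F (u, t)" "\<lambda>u. partial_fst F (u, t)"])
        (use uv M D in \<open>auto intro: has_field_derivative_at_within\<close>)
    moreover have "norm (F (v, t) - F (v, r)) \<le> M * norm (t - r)"
      by (rule field_differentiable_bound[of "{0..T}" "\<lambda>t. F (v, t)" "\<lambda>t. partial_snd F (v, t)"])
        (use uv M D in \<open>auto intro: has_field_derivative_at_within\<close>)
    ultimately show ?thesis
      by (simp add: algebra_simps)
  qed
  moreover have "M \<ge> 0"
    by (simp add: M_def)
  ultimately show ?thesis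
    by blast
qed

section \<open>From the residual to the error\<close>

text \<open>Gronwall's argument for the square of the error: by \<open>2 |e| |r| \<le> e\<^sup>2 + r\<^sup>2\<close> the derivative of \<open>e\<^sup>2\<close> is
  at most \<open>(2 M + 1) e\<^sup>2 + r\<^sup>2\<close>. Working with \<open>e\<^sup>2\<close> brings in the integral of \<open>r\<^sup>2\<close> directly, which
  is the quantity that a least-squares fit controls.\<close>

lemma error_le_L2_residual:
  fixes e e' r :: "real \<Rightarrow> real"
  assumes "M \<ge> 0" "t \<in> {0..T}" "e 0 = 0"
    and D: "\<And>t. t \<in> {0..T} \<Longrightarrow> (e has_real_derivative e' t) (at t within {0..T})"
    and bound: "\<And>t. t \<in> {0..T} \<Longrightarrow> \<bar>e' t\<bar> \<le> M * \<bar>e t\<bar> + \<bar>r t\<bar>"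
    and cont: "continuous_on {0..T} r"
  shows "(e t)\<^sup>2 \<le> exp ((2 * M + 1) * T) * integral {0..T} (\<lambda>t. (r t)\<^sup>2)"
proof -
  define K where "K = 2 * M + 1"
  define \<psi> where "\<psi> t = exp (- K * t) * (e t)\<^sup>2 - integral {0..t} (\<lambda>t. (r t)\<^sup>2)" for t
  have K: "K \<ge> 0"
    using assms(1) by (simp add: K_def)
  have cont2: "continuous_on {0..T} (\<lambda>t. (r t)\<^sup>2)"
    by (intro continuous_intros cont)
  have energy: "2 * e u * e' u \<le> K * (e u)\<^sup>2 + (r u)\<^sup>2" if "u \<in> {0..T}" for u
  proof -
    have "2 * e u * e' u \<le> 2 * \<bar>e u\<bar> * \<bar>e' u\<bar>"
      using abs_ge_self[of "2 * e u * e' u"] by (simp add: abs_mult)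
    also have "\<dots> \<le> 2 * \<bar>e u\<bar> * (M * \<bar>e u\<bar> + \<bar>r u\<bar>)"
      using bound[OF that] by (intro mult_left_mono) auto
    also have "\<dots> = 2 * M * (e u)\<^sup>2 + 2 * \<bar>e u\<bar> * \<bar>r u\<bar>"
      by (simp add: algebra_simps power2_eq_square)
    also have "2 * \<bar>e u\<bar> * \<bar>r u\<bar> \<le> (e u)\<^sup>2 + (r u)\<^sup>2"
      using sum_squares_bound[of "\<bar>e u\<bar>" "\<bar>r u\<bar>"] by simp
    finally show ?thesis
      by (simp add: K_def algebra_simps)
  qed
  have D\<psi>: "(\<psi> has_real_derivative
      exp (- K * u) * (2 * e u * e' u - K * (e u)\<^sup>2) - (r u)\<^sup>2) (at u within {0..T})"
    if "u \<in> {0..T}" for u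
    unfolding \<psi>_def
    by (rule derivative_eq_intros D that integral_has_real_derivative cont2 refl
        | simp add: algebra_simps)+
  have nonpos: "exp (- K * u) * (2 * e u * e' u - K * (e u)\<^sup>2) - (r u)\<^sup>2 \<le> 0"
    if u: "u \<in> {0..T}" for u
  proof -
    have "exp (- K * u) * (2 * e u * e' u - K * (e u)\<^sup>2) \<le> exp (- K * u) * (r u)\<^sup>2"
      using energy[OF u] by (intro mult_left_mono) auto
    also have "\<dots> \<le> 1 * (r u)\<^sup>2"
      using K u by (intro mult_right_mono) auto
    finally show ?thesis
      by simp
  qed
  have sub: "{0..t} \<subseteq> {0..T}"
    using assms(2) by auto
  have "\<exists>u\<in>{0..t}. \<psi> t - \<psi> 0 =
      (exp (- K * u) * (2 * e u * e' u - K * (e u)\<^sup>2) - (r u)\<^sup>2) * (t - 0)"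
    using assms(2) sub
    by (intro mvt_very_simple has_field_derivative_imp_has_derivative DERIV_subset[OF D\<psi>]) auto
  then obtain u where "u \<in> {0..t}" and u: "\<psi> t - \<psi> 0 =
      (exp (- K * u) * (2 * e u * e' u - K * (e u)\<^sup>2) - (r u)\<^sup>2) * (t - 0)"
    by blast
  then have "\<psi> t \<le> \<psi> 0"
    using nonpos[of u] assms(2) sub mult_nonpos_nonneg[of _ t] by fastforce
  also have "\<psi> 0 = 0"
    using assms(3) by (simp add: \<psi>_def)
  finally have "exp (- K * t) * (e t)\<^sup>2 \<le> integral {0..t} (\<lambda>t. (r t)\<^sup>2)"
    by (simp add: \<psi>_def)
  also have "\<dots> \<le> integral {0..T} (\<lambda>t. (r t)\<^sup>2)"
    using sub cont2
    by (intro integral_subset_le integrable_continuous_real continuous_on_subset[OF cont2]) auto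
  finally have I: "exp (- K * t) * (e t)\<^sup>2 \<le> integral {0..T} (\<lambda>t. (r t)\<^sup>2)" .
  have "(e t)\<^sup>2 = exp (K * t) * (exp (- K * t) * (e t)\<^sup>2)"
    by (simp add: exp_minus_inverse flip: mult.assoc)
  also have "\<dots> \<le> exp (K * T) * integral {0..T} (\<lambda>t. (r t)\<^sup>2)"
    using K assms(2) I by (intro mult_mono) (auto intro: mult_left_mono)
  finally show ?thesis
    by (simp add: K_def)
qed

section \<open>The error of the least-squares spline\<close>

theorem theorem4p1:
  fixes T x0 :: real and F :: "real \<times> real \<Rightarrow> real" and x :: "real \<Rightarrow> real"
  assumes "T > 0"
    and "unique_ode_solution F T x0 x"
    and "continuous_partials 3 F"
    and "\<forall>t\<in>{0..T}. partial_fst F (x t, t) < 0"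
  shows "\<exists>\<delta>\<^sub>2 > 0. \<exists>\<beta>\<^sub>1 \<beta>\<^sub>2 \<beta>\<^sub>3 \<beta>\<^sub>4 \<beta>\<^sub>5 \<beta>\<^sub>6 :: real.
    \<forall>(k :: nat) (\<tau> :: nat \<Rightarrow> real) (xh :: real \<Rightarrow> real).
      knots T k \<tau> \<longrightarrow> mesh k \<tau> \<le> 1 \<longrightarrow>
      is_arg_min (J F T)
        (\<lambda>s. s \<in> cubic_splines T k \<tau> \<and> s 0 = x0 \<and> sup_norm T (\<lambda>t. s t - x t) < \<delta>\<^sub>2) xh \<longrightarrow>
      sup_norm T (\<lambda>t. x t - xh t) <
        \<beta>\<^sub>1 * mesh_ratio k \<tau> * L2_norm_on T (ddt T (ddt T xh)) * mesh k \<tau> powr (1 / 2)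
        + \<beta>\<^sub>2 * mesh_ratio k \<tau> * mesh k \<tau>
        + mesh_ratio k \<tau> * (4 * sqrt (6 * mesh_ratio k \<tau>) + \<beta>\<^sub>3) * \<beta>\<^sub>4 * sqrt T * mesh k \<tau> powr (3 / 2)
        + \<beta>\<^sub>5 * sqrt T * mesh k \<tau> ^ 3
        + \<beta>\<^sub>6 * sqrt T * mesh k \<tau> powr (7 / 2)"
proof -
  have x_0: "x 0 = x0" and Dx: "\<And>t. t \<in> {0..T} \<Longrightarrow> (x has_real_derivative F (x t, t)) (at t within {0..T})"
    using assms(2) by (auto simp: unique_ode_solution_def ode_solution_def)
  have contF: "continuous_on UNIV F"
    using assms(3) by (simp add: numeral_3_eq_3)
  have contx: "continuous_on {0..T} x"
    by (rule DERIV_continuous_on) (rule Dx)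
  have contFy: "continuous_on {0..T} (\<lambda>t. F (y t, t))" if "continuous_on {0..T} y" for y
    by (rule continuous_on_compose2[OF contF]) (auto intro!: continuous_intros that)
  obtain R0 where "R0 \<ge> 0" and R0: "\<And>t. t \<in> {0..T} \<Longrightarrow> \<bar>x t\<bar> \<le> R0"
    using continuous_on_Icc_bounded[OF contx] by blast
  obtain G where "G \<ge> 0" and G: "\<And>t. t \<in> {0..T} \<Longrightarrow> \<bar>F (x t, t)\<bar> \<le> G"
    using continuous_on_Icc_bounded[OF contFy[OF contx]] by blast
  have "continuous_partials (Suc 2) F" "0 \<le> R0 + 1" "0 \<le> T"
    using assms \<open>R0 \<ge> 0\<close> by (simp_all add: numeral_3_eq_3 numeral_2_eq_2)
  from continuous_partials_imp_Lipschitz_on_box[OF this]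
  obtain M where "M \<ge> 0" and M: "\<And>u v t r. u \<in> {-(R0 + 1)..R0 + 1} \<Longrightarrow> v \<in> {-(R0 + 1)..R0 + 1} \<Longrightarrow>
      t \<in> {0..T} \<Longrightarrow> r \<in> {0..T} \<Longrightarrow> \<bar>F (u, t) - F (v, r)\<bar> \<le> M * (\<bar>u - v\<bar> + \<bar>t - r\<bar>)"
    by blast
  have tube: "\<bar>F (y, t) - F (x t, t)\<bar> \<le> M * \<bar>y - x t\<bar>"
    if "t \<in> {0..T}" "\<bar>y - x t\<bar> \<le> 1" for y t
    using M[of y "x t" t t] R0[OF that(1)] that by (auto simp: abs_le_iff)
  \<comment> \<open>\<open>\<^bold>x\<close> has Lipschitz constant \<open>G\<close>, so \<open>(\<^bold>x t, t)\<close> moves by at most \<open>(G + 1) |t - r|\<close>.\<close>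
  define L where "L = M * (G + 1)"
  have "L \<ge> 0"
    using \<open>M \<ge> 0\<close> \<open>G \<ge> 0\<close> by (simp add: L_def)
  have lip: "L-lipschitz_on {0..T} (\<lambda>t. F (x t, t))"
  proof (rule lipschitz_onI)
    fix t r assume tr: "t \<in> {0..T}" "r \<in> {0..T}"
    have "norm (x t - x r) \<le> G * norm (t - r)"
      by (rule field_differentiable_bound[of "{0..T}" x "\<lambda>t. F (x t, t)"]) (use tr G Dx in auto)
    then have "M * (\<bar>x t - x r\<bar> + \<bar>t - r\<bar>) \<le> M * (G * \<bar>t - r\<bar> + \<bar>t - r\<bar>)"
      using \<open>M \<ge> 0\<close> by (intro mult_left_mono) auto
    moreover have "\<bar>F (x t, t) - F (x r, r)\<bar> \<le> M * (\<bar>x t - x r\<bar> + \<bar>t - r\<bar>)"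
      using R0 tr by (intro M) (force simp: abs_le_iff)+
    ultimately show "dist (F (x t, t)) (F (x r, r)) \<le> L * dist t r"
      by (simp add: dist_real_def L_def algebra_simps)
  qed (fact \<open>L \<ge> 0\<close>)
  \<comment> \<open>\<open>C |\<tau>|\<close> will bound the residual of the comparison spline: \<open>2 L |\<tau>|\<close> comes from its derivative and
    \<open>M\<close> times \<open>2 L T |\<tau>|\<close> from its values. \<open>B |\<tau>|\<close> is the bound on the error that Gronwall's argument
    then gives for the minimizer.\<close>
  define C where "C = 2 * L * (1 + M * T)"
  define B where "B = sqrt (exp ((2 * M + 1) * T) * T) * C"
  have "C \<ge> 0" "B \<ge> 0"
    using \<open>M \<ge> 0\<close> \<open>L \<ge> 0\<close> \<open>T > 0\<close> by (auto simp: B_def C_def)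
  have main: "sup_norm T (\<lambda>t. x t - xh t) < (B + 2 * L * T + 1) * mesh_ratio k \<tau> * mesh k \<tau>"
    if k: "knots T k \<tau>" and argmin: "is_arg_min (J F T)
        (\<lambda>s. s \<in> cubic_splines T k \<tau> \<and> s 0 = x0 \<and> sup_norm T (\<lambda>t. s t - x t) < 1) xh"
    for k \<tau> xh
  proof -
    let ?h = "mesh k \<tau>"
    have h: "?h > 0" and \<kappa>: "mesh_ratio k \<tau> \<ge> 1"
      using mesh_pos_and_ratio_ge_1[OF k] by auto
    have xh: "xh \<in> cubic_splines T k \<tau>" "xh 0 = x0" "sup_norm T (\<lambda>t. xh t - x t) < 1"
      using argmin unfolding is_arg_min_def by blast+
    have least: "J F T xh \<le> J F T s" if "s \<in> cubic_splines T k \<tau>" "s 0 = x0"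
        "sup_norm T (\<lambda>t. s t - x t) < 1" for s
      using argmin that unfolding is_arg_min_def not_less[symmetric] by blast
    have diffxh: "xh differentiable_on {0..T}" "ddt T xh differentiable_on {0..T}"
      using xh(1) by (simp_all add: cubic_splines_def)
    have contxh: "continuous_on {0..T} xh" "continuous_on {0..T} (ddt T xh)"
      using diffxh by (simp_all add: differentiable_imp_continuous_on)
    have near: "\<bar>xh t - x t\<bar> < 1" if "t \<in> {0..T}" for t
      by (rule sup_norm_lessD[OF _ xh(3) that]) (intro continuous_intros contxh contx)
    have "sup_norm T (\<lambda>t. x t - xh t) \<le> (B + 2 * L * T) * ?h"
    proof (cases "2 * L * T * ?h < 1")
      case False
      show ?thesis
      proof (rule sup_norm_leI)
        fix t assume "t \<in> {0..T}"
        from near[OF this] False have "\<bar>x t - xh t\<bar> \<le> 2 * L * T * ?h"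
          by linarith
        also have "\<dots> \<le> (B + 2 * L * T) * ?h"
          using \<open>B \<ge> 0\<close> h by (simp add: algebra_simps)
        finally show "\<bar>x t - xh t\<bar> \<le> (B + 2 * L * T) * ?h" .
      qed (use \<open>T > 0\<close> in simp)
    next
      case True
      obtain s s1 where s: "s \<in> cubic_splines T k \<tau>" "s 0 = x0" "continuous_on UNIV s1"
        and Ds: "\<And>t. (s has_real_derivative s1 t) (at t)"
        and s1: "\<And>t. t \<in> {0..T} \<Longrightarrow> \<bar>s1 t - F (x t, t)\<bar> \<le> 2 * L * ?h"
        using spline_with_derivative_near_Lipschitz_function[OF \<open>T > 0\<close> k lip, of x0] by blast
      have s_near: "\<bar>s t - x t\<bar> \<le> 2 * L * T * ?h" if t: "t \<in> {0..T}" for t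
      proof -
        have "norm ((s t - x t) - (s 0 - x 0)) \<le> 2 * L * ?h * norm (t - 0)"
          by (rule field_differentiable_bound[of "{0..T}" "\<lambda>t. s t - x t" "\<lambda>t. s1 t - F (x t, t)"])
            (use t s1 Dx Ds in \<open>auto intro!: derivative_intros intro: has_field_derivative_at_within\<close>)
        also have "\<dots> \<le> 2 * L * ?h * T"
          using t h \<open>L \<ge> 0\<close> by (intro mult_left_mono) auto
        finally show ?thesis
          using s(2) x_0 by (simp add: mult_ac)
      qed
      have "sup_norm T (\<lambda>t. s t - x t) \<le> 2 * L * T * ?h"
        using s_near \<open>T > 0\<close> by (intro sup_norm_leI) auto
      then have "J F T xh \<le> J F T s"
        using least s True by auto
      also have "J F T s = integral {0..T} (\<lambda>t. (s1 t - F (s t, t))\<^sup>2)"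
        unfolding J_def using ddt_eqI[OF \<open>T > 0\<close> _ has_field_derivative_at_within[OF Ds]]
        by (intro integral_cong) auto
      also have "\<dots> \<le> integral {0..T} (\<lambda>t. (C * ?h)\<^sup>2)"
      proof (rule integral_le)
        have "continuous_on {0..T} s"
          by (rule DERIV_continuous_on) (rule has_field_derivative_at_within[OF Ds])
        then show "(\<lambda>t. (s1 t - F (s t, t))\<^sup>2) integrable_on {0..T}"
          by (intro integrable_continuous_real continuous_intros contFy continuous_on_subset[OF s(3)]) auto
        fix t assume t: "t \<in> {0..T}"
        have "\<bar>F (s t, t) - F (x t, t)\<bar> \<le> M * (2 * L * T * ?h)"
          using tube[OF t, of "s t"] s_near[OF t] True mult_left_mono[OF s_near[OF t] \<open>M \<ge> 0\<close>] by linarith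
        with s1[OF t] have "\<bar>s1 t - F (s t, t)\<bar> \<le> 2 * L * ?h + M * (2 * L * T * ?h)"
          by linarith
        also have "\<dots> = C * ?h"
          by (simp add: C_def algebra_simps)
        finally show "(s1 t - F (s t, t))\<^sup>2 \<le> (C * ?h)\<^sup>2"
          by (metis abs_ge_zero power2_abs power_mono)
      qed auto
      also have "\<dots> = T * (C * ?h)\<^sup>2"
        using \<open>T > 0\<close> by simp
      finally have J: "J F T xh \<le> T * (C * ?h)\<^sup>2" .
      have "\<bar>x t - xh t\<bar> \<le> B * ?h" if t: "t \<in> {0..T}" for t
      proof -
        let ?r = "\<lambda>t. ddt T xh t - F (xh t, t)"
        have "(xh t - x t)\<^sup>2 \<le> exp ((2 * M + 1) * T) * integral {0..T} (\<lambda>t. (?r t)\<^sup>2)"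
        proof (rule error_le_L2_residual[where e = "\<lambda>t. xh t - x t"
              and e' = "\<lambda>t. ddt T xh t - F (x t, t)"])
          show "continuous_on {0..T} ?r"
            by (intro continuous_intros contFy contxh)
          fix u assume u: "u \<in> {0..T}"
          have "(xh has_real_derivative ddt T xh u) (at u within {0..T})"
            using diffxh(1) u vector_derivative_works[of xh "at u within {0..T}"]
            by (auto simp: differentiable_on_def ddt_def has_real_derivative_iff_has_vector_derivative)
          then show "((\<lambda>t. xh t - x t) has_real_derivative ddt T xh u - F (x u, u)) (at u within {0..T})"
            by (intro derivative_intros Dx u)
          show "\<bar>ddt T xh u - F (x u, u)\<bar> \<le> M * \<bar>xh u - x u\<bar> + \<bar>?r u\<bar>"
            using tube[OF u, of "xh u"] near[OF u] by linarith
        qed (use t \<open>M \<ge> 0\<close> xh(2) x_0 in auto)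
        also have "\<dots> \<le> exp ((2 * M + 1) * T) * (T * (C * ?h)\<^sup>2)"
          using J by (intro mult_left_mono) (auto simp: J_def)
        also have "\<dots> = (B * ?h)\<^sup>2"
          using \<open>T > 0\<close> by (simp add: B_def power_mult_distrib)
        finally have "\<bar>xh t - x t\<bar> \<le> \<bar>B * ?h\<bar>"
          by (simp add: abs_le_square_iff)
        then show ?thesis
          using \<open>B \<ge> 0\<close> h by (simp add: abs_minus_commute)
      qed
      then have "sup_norm T (\<lambda>t. x t - xh t) \<le> B * ?h"
        using \<open>T > 0\<close> by (intro sup_norm_leI) auto
      also have "\<dots> \<le> (B + 2 * L * T) * ?h"
        using \<open>L \<ge> 0\<close> \<open>T > 0\<close> h by (intro mult_right_mono) auto
      finally show ?thesis .
    qed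
    also have "\<dots> < (B + 2 * L * T + 1) * 1 * ?h"
      using h by simp
    also have "\<dots> \<le> (B + 2 * L * T + 1) * mesh_ratio k \<tau> * ?h"
      using h \<kappa> \<open>B \<ge> 0\<close> \<open>L \<ge> 0\<close> \<open>T > 0\<close> by (intro mult_right_mono mult_left_mono) auto
    finally show ?thesis .
  qed
  show ?thesis
    by (rule exI[of _ 1], rule conjI, simp, rule exI[of _ 0], rule exI[of _ "B + 2 * L * T + 1"],
        (rule exI[of _ 0])+) (use main in simp)
qed

end
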